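(* Let $\mathcal{S}$ be a thick finite generalized quadrangle of order $s$ with a regular point $x$, and suppose that there is a group $\mathbb{S}\le \mathrm{Aut}(\mathcal{S})_x$ of order $s$ consisting of symmetries with center $x$. Let $\mathcal{P}(\mathcal{S},x)$ be the Payne-derived quadrangle and let $\Pi(x)$ be the affine plane of order $s$ associated with $x$. (i) If $G$ is a Singer group of $\mathcal{P}(\mathcal{S},x)$ which is induced by a subgroup $\overline{G}\le \mathrm{Aut}(\mathcal{S})_x$ with $\mathbb{S}\le\overline{G}$, then $\overline{G}/\mathbb{S}$ is an automorphism group of $\Pi(x)$ which acts sharply transitively on the points of $\Pi(x)$. (ii) Conversely, let $K$ be a subgroup of $\mathrm{Aut}(\Pi(x))$ which acts sharply transitively on the points of $\Pi(x)$, and suppose that $K$ is induced by some group $K^{\#}\le \mathrm{Aut}(\mathcal{S})_x$. Then $\overline{K}=\langle \mathbb{S},K^{\#}\rangle$ induces a Singer group of $\mathcal{P}(\mathcal{S},x)$.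
   Context: For a generalized quadrangle (GQ), $y\sim z$ means that the points $y,z$ are collinear ($y\sim y$ allowed), $y^\perp=\{z: z\sim y\}$, $A^\perp=\bigcap_{a\in A}a^\perp$, and $A^{\perp\perp}=(A^\perp)^\perp$. A GQ of order $s$ has $s+1$ points on each line and $s+1$ lines through each point. A point $x$ of a GQ of order $s$ is regular if $|\{x,y\}^{\perp\perp}|=s+1$ for all $y\not\sim x$. A symmetry with center $x$ is an automorphism fixing every point of $x^\perp$. The Payne-derived GQ $\mathcal{P}(\mathcal{S},x)$ (a GQ of order $(s-1,s+1)$) has as points the points of $\mathcal{S}$ not collinear with $x$, and as lines the lines of $\mathcal{S}$ not through $x$ together with the sets $\{x,r\}^{\perp\perp}\setminus\{x\}$ with $r\not\sim x$; incidence is the natural one. $\Pi(x)$ is the affine plane of order $s$ whose points are the sets $\{x,z\}^\perp$ with $z\not\sim x$ and whose lines are the elements of $x^\perp\setminus\{x\}$, with incidence given by containment. $\mathrm{Aut}(\mathcal{S})_x$ acts naturally on $\mathcal{P}(\mathcal{S},x)$ and on $\Pi(x)$, with $\mathbb{S}$ acting trivially on $\Pi(x)$; "induced" refers to these actions. A Singer group of a GQ is a group of automorphisms acting sharply transitively on its point set. *)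

theory Defs
  imports "HOL-Algebra.Algebra"
begin

section \<open>Incidence structures and their automorphism groups\<close>

text \<open>The relation \<open>incident\<close> is only ever consulted on \<open>points S \<times> lines S\<close>.\<close>

record ('p, 'l) incidence_structure =
  points :: "'p set"
  lines :: "'l set"
  incident :: "'p \<Rightarrow> 'l \<Rightarrow> bool"

definition automorphisms ::
    "('p, 'l) incidence_structure \<Rightarrow> (('p \<Rightarrow> 'p) \<times> ('l \<Rightarrow> 'l)) set" where
  "automorphisms S = {(g, h). g \<in> Bij (points S) \<and> h \<in> Bij (lines S) \<and>
     (\<forall>p\<in>points S. \<forall>l\<in>lines S. incident S (g p) (h l) \<longleftrightarrow> incident S p l)}"

text \<open>An automorphism is a pair consisting of its action on points (first component) and
  its action on lines (second component); multiplication is composition.\<close>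

definition aut_group ::
    "('p, 'l) incidence_structure \<Rightarrow> (('p \<Rightarrow> 'p) \<times> ('l \<Rightarrow> 'l)) monoid" where
  "aut_group S = (BijGroup (points S) \<times>\<times> BijGroup (lines S))\<lparr>carrier := automorphisms S\<rparr>"

definition aut_stabilizer ::
    "('p, 'l) incidence_structure \<Rightarrow> 'p \<Rightarrow> (('p \<Rightarrow> 'p) \<times> ('l \<Rightarrow> 'l)) monoid" where
  "aut_stabilizer S x = (aut_group S)\<lparr>carrier := stabilizer (aut_group S) fst x\<rparr>"

definition sharply_transitive :: "'g set \<Rightarrow> ('g \<Rightarrow> 'a \<Rightarrow> 'a) \<Rightarrow> 'a set \<Rightarrow> bool" where
  "sharply_transitive G act E \<longleftrightarrow> (\<forall>p\<in>E. \<forall>q\<in>E. \<exists>!g. g \<in> G \<and> act g p = q)"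

definition singer_group ::
    "('p, 'l) incidence_structure \<Rightarrow> (('p \<Rightarrow> 'p) \<times> ('l \<Rightarrow> 'l)) set \<Rightarrow> bool" where
  "singer_group S G \<longleftrightarrow> subgroup G (aut_group S) \<and> sharply_transitive G fst (points S)"

lemma carrier_BijGroup: "carrier (BijGroup E) = Bij E"
  by (simp add: BijGroup_def)

lemma subgroup_automorphisms:
  "subgroup (automorphisms S) (BijGroup (points S) \<times>\<times> BijGroup (lines S))"
proof -
  let ?P = "BijGroup (points S)" and ?L = "BijGroup (lines S)"
  interpret D: group "?P \<times>\<times> ?L"
    by (intro DirProd_group group_BijGroup)
  show ?thesis
  proof (rule D.subgroupI)
    show "automorphisms S \<subseteq> carrier (?P \<times>\<times> ?L)"
      by (auto simp: automorphisms_def BijGroup_def)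
    have "((\<lambda>p\<in>points S. p), (\<lambda>l\<in>lines S. l)) \<in> automorphisms S"
      by (simp add: automorphisms_def id_Bij)
    then show "automorphisms S \<noteq> {}"
      by blast
  next
    fix a assume a: "a \<in> automorphisms S"
    obtain g h where gh: "a = (g, h)" by (cases a)
    with a have g: "g \<in> Bij (points S)" and h: "h \<in> Bij (lines S)"
      and inc: "\<And>p l. p \<in> points S \<Longrightarrow> l \<in> lines S \<Longrightarrow> incident S (g p) (h l) \<longleftrightarrow> incident S p l"
      by (auto simp: automorphisms_def)
    have *: "inv\<^bsub>?P \<times>\<times> ?L\<^esub> a =
        ((\<lambda>p\<in>points S. inv_into (points S) g p), (\<lambda>l\<in>lines S. inv_into (lines S) h l))"
      unfolding gh using g h
      by (subst inv_DirProd) (simp_all add: group_BijGroup inv_BijGroup carrier_BijGroup)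
    have "incident S (inv_into (points S) g p) (inv_into (lines S) h l) \<longleftrightarrow> incident S p l"
      if "p \<in> points S" "l \<in> lines S" for p l
      using inc[OF Bij_inv_into_mem[OF g that(1)] Bij_inv_into_mem[OF h that(2)]] g h that
      by (simp add: Bij_def bij_betw_inv_into_right[of g "points S" "points S"]
          bij_betw_inv_into_right[of h "lines S" "lines S"])
    then show "inv\<^bsub>?P \<times>\<times> ?L\<^esub> a \<in> automorphisms S"
      unfolding * using g h by (simp add: automorphisms_def restrict_inv_into_Bij)
  next
    fix a b assume ab: "a \<in> automorphisms S" "b \<in> automorphisms S"
    obtain g h g' h' where e: "a = (g, h)" "b = (g', h')" by (cases a, cases b)
    have m: "g' p \<in> points S" "h' l \<in> lines S" if "p \<in> points S" "l \<in> lines S" for p l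
      using ab that by (auto simp: e automorphisms_def Bij_def bij_betw_def)
    show "a \<otimes>\<^bsub>?P \<times>\<times> ?L\<^esub> b \<in> automorphisms S"
      using ab m by (auto simp: e automorphisms_def BijGroup_def compose_Bij compose_eq)
  qed
qed

lemma group_aut_group: "group (aut_group S)"
  unfolding aut_group_def
  by (intro subgroup.subgroup_is_group subgroup_automorphisms DirProd_group group_BijGroup)


section \<open>Generalized quadrangles\<close>

locale generalized_quadrangle =
  fixes S :: "('p, 'l) incidence_structure" and s t :: nat
  assumes nonempty: "points S \<noteq> {}" "lines S \<noteq> {}"
    and order_pos: "1 \<le> s" "1 \<le> t"
    and points_on_line: "l \<in> lines S \<Longrightarrow> card {p \<in> points S. incident S p l} = s + 1"
    and lines_on_point: "p \<in> points S \<Longrightarrow> card {l \<in> lines S. incident S p l} = t + 1"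
    and partial_linear: "\<lbrakk>p \<in> points S; q \<in> points S; l \<in> lines S; m \<in> lines S;
        incident S p l; incident S q l; incident S p m; incident S q m\<rbrakk> \<Longrightarrow> p = q \<or> l = m"
    and projection: "\<lbrakk>p \<in> points S; l \<in> lines S; \<not> incident S p l\<rbrakk> \<Longrightarrow>
        \<exists>!(q, m). q \<in> points S \<and> m \<in> lines S \<and> incident S p m \<and> incident S q m \<and> incident S q l"

definition finite_structure :: "('p, 'l) incidence_structure \<Rightarrow> bool" where
  "finite_structure S \<longleftrightarrow> finite (points S) \<and> finite (lines S)"

definition thick :: "('p, 'l) incidence_structure \<Rightarrow> bool" where
  "thick S \<longleftrightarrow> (\<forall>l\<in>lines S. 3 \<le> card {p \<in> points S. incident S p l}) \<and>
               (\<forall>p\<in>points S. 3 \<le> card {l \<in> lines S. incident S p l})"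

definition collinear :: "('p, 'l) incidence_structure \<Rightarrow> 'p \<Rightarrow> 'p \<Rightarrow> bool" where
  "collinear S y z \<longleftrightarrow> y = z \<or> (\<exists>l\<in>lines S. incident S y l \<and> incident S z l)"

definition perp :: "('p, 'l) incidence_structure \<Rightarrow> 'p set \<Rightarrow> 'p set" where
  "perp S A = {z \<in> points S. \<forall>a\<in>A. collinear S z a}"

definition regular_point :: "('p, 'l) incidence_structure \<Rightarrow> nat \<Rightarrow> 'p \<Rightarrow> bool" where
  "regular_point S s x \<longleftrightarrow> x \<in> points S \<and>
     (\<forall>y\<in>points S. \<not> collinear S y x \<longrightarrow> card (perp S (perp S {x, y})) = s + 1)"

definition is_symmetry ::
    "('p, 'l) incidence_structure \<Rightarrow> 'p \<Rightarrow> ('p \<Rightarrow> 'p) \<times> ('l \<Rightarrow> 'l) \<Rightarrow> bool" where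
  "is_symmetry S x g \<longleftrightarrow> g \<in> automorphisms S \<and> (\<forall>z\<in>perp S {x}. fst g z = z)"


section \<open>The Payne-derived quadrangle and the affine plane at a regular point\<close>

text \<open>Lines of the derived structure: \<open>Inl l\<close> for the lines of \<open>S\<close> not through \<open>x\<close>, and
  \<open>Inr B\<close> for the point sets obtained from the spans \<open>{x, r}\<^sup>\<bottom>\<^sup>\<bottom>\<close>.\<close>

definition payne_derived ::
    "('p, 'l) incidence_structure \<Rightarrow> 'p \<Rightarrow> ('p, 'l + 'p set) incidence_structure" where
  "payne_derived S x = \<lparr>
     points = {y \<in> points S. \<not> collinear S y x},
     lines = Inl ` {l \<in> lines S. \<not> incident S x l} \<union>
             Inr ` {perp S (perp S {x, r}) - {x} | r. r \<in> points S \<and> \<not> collinear S r x},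
     incident = (\<lambda>y m. case m of Inl l \<Rightarrow> incident S y l | Inr B \<Rightarrow> y \<in> B)\<rparr>"

definition affine_plane_at ::
    "('p, 'l) incidence_structure \<Rightarrow> 'p \<Rightarrow> ('p set, 'p) incidence_structure" where
  "affine_plane_at S x = \<lparr>
     points = {perp S {x, z} | z. z \<in> points S \<and> \<not> collinear S z x},
     lines = perp S {x} - {x},
     incident = (\<lambda>A y. y \<in> A)\<rparr>"

definition payne_action :: "('p, 'l) incidence_structure \<Rightarrow> 'p \<Rightarrow>
    ('p \<Rightarrow> 'p) \<times> ('l \<Rightarrow> 'l) \<Rightarrow> ('p \<Rightarrow> 'p) \<times> ('l + 'p set \<Rightarrow> 'l + 'p set)" where
  "payne_action S x g =
     (restrict (fst g) (points (payne_derived S x)),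
      restrict (map_sum (snd g) (image (fst g))) (lines (payne_derived S x)))"

definition plane_action :: "('p, 'l) incidence_structure \<Rightarrow> 'p \<Rightarrow>
    ('p \<Rightarrow> 'p) \<times> ('l \<Rightarrow> 'l) \<Rightarrow> ('p set \<Rightarrow> 'p set) \<times> ('p \<Rightarrow> 'p)" where
  "plane_action S x g =
     (restrict (image (fst g)) (points (affine_plane_at S x)),
      restrict (fst g) (lines (affine_plane_at S x)))"

end

theory Submission
  imports Defs
begin

text \<open>A symmetry about \<open>x\<close> that fixes a point not collinear with \<open>x\<close> is trivial. Hence every orbit of
  \<open>SS\<close> on the points not collinear with \<open>x\<close> has \<open>s\<close> elements; since symmetries preserve traces
  \<open>{x, z}\<^sup>\<bottom>\<close> and, by regularity, at most \<open>s\<close> points share a trace, the orbits are exactly the fibres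
  of \<open>z \<mapsto> {x, z}\<^sup>\<bottom>\<close>, that is, the points of the affine plane. Consequently \<open>SS\<close> contains all
  symmetries about \<open>x\<close> and is the kernel of the action of the stabilizer on the plane, while the
  action on the derived quadrangle is faithful. Sharp transitivity then passes between the derived
  quadrangle and its quotient by \<open>SS\<close>.\<close>

section \<open>Automorphisms\<close>

context
  fixes S :: "('p, 'l) incidence_structure" and g
  assumes g: "g \<in> automorphisms S"
begin

lemma automorphism_bij:
  "bij_betw (fst g) (points S) (points S)" "bij_betw (snd g) (lines S) (lines S)"
  using g by (auto simp: automorphisms_def Bij_def)

lemma automorphism_point [simp]: "p \<in> points S \<Longrightarrow> fst g p \<in> points S"
  using automorphism_bij(1) by (auto simp: bij_betw_def)

lemma automorphism_line [simp]: "l \<in> lines S \<Longrightarrow> snd g l \<in> lines S"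
  using automorphism_bij(2) by (auto simp: bij_betw_def)

lemma automorphism_incident [simp]:
  "p \<in> points S \<Longrightarrow> l \<in> lines S \<Longrightarrow> incident S (fst g p) (snd g l) \<longleftrightarrow> incident S p l"
  using g by (auto simp: automorphisms_def)

lemma automorphism_point_eq [simp]:
  "p \<in> points S \<Longrightarrow> q \<in> points S \<Longrightarrow> fst g p = fst g q \<longleftrightarrow> p = q"
  using automorphism_bij(1) by (auto simp: bij_betw_def inj_on_eq_iff)

lemma automorphism_line_surj: "l \<in> lines S \<Longrightarrow> \<exists>m\<in>lines S. snd g m = l"
  using automorphism_bij(2) by (metis bij_betw_imp_surj_on imageE)

lemma automorphism_point_surj: "p \<in> points S \<Longrightarrow> \<exists>q\<in>points S. fst g q = p"
  using automorphism_bij(1) by (metis bij_betw_imp_surj_on imageE)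

lemma automorphism_collinear [simp]:
  assumes "p \<in> points S" "q \<in> points S"
  shows "collinear S (fst g p) (fst g q) \<longleftrightarrow> collinear S p q"
proof -
  \<comment> \<open>Every line is some \<open>snd g m\<close>, so a joining line of the images pulls
    back to a joining line of \<open>p\<close> and \<open>q\<close>.\<close>
  have "(\<exists>l\<in>lines S. incident S (fst g p) l \<and> incident S (fst g q) l) \<longleftrightarrow>
        (\<exists>m\<in>lines S. incident S (fst g p) (snd g m) \<and> incident S (fst g q) (snd g m))"
    by (metis automorphism_line automorphism_line_surj)
  with assms show ?thesis
    by (simp add: collinear_def cong: bex_cong)
qed

lemma automorphism_perp:
  assumes "A \<subseteq> points S"
  shows "fst g ` perp S A = perp S (fst g ` A)"
proof (intro equalityI subsetI)
  fix q assume "q \<in> fst g ` perp S A"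
  with assms show "q \<in> perp S (fst g ` A)"
    by (auto simp: perp_def subset_iff)
next
  fix q assume q: "q \<in> perp S (fst g ` A)"
  then obtain p where "p \<in> points S" "q = fst g p"
    using automorphism_point_surj[of q] by (auto simp: perp_def)
  with q assms show "q \<in> fst g ` perp S A"
    by (auto simp: perp_def subset_iff)
qed

end

lemma collinear_refl [simp]: "collinear S p p"
  by (simp add: collinear_def)

lemma collinear_sym: "collinear S p q \<longleftrightarrow> collinear S q p"
  by (auto simp: collinear_def)

lemma perp_subset [simp]: "perp S A \<subseteq> points S"
  by (auto simp: perp_def)

section \<open>Group operations on automorphisms and stabilizers\<close>

lemma carrier_aut_group [simp]: "carrier (aut_group S) = automorphisms S"
  by (simp add: aut_group_def)

lemma mult_aut_group:
  assumes "g \<in> automorphisms S" "h \<in> automorphisms S"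
  shows "g \<otimes>\<^bsub>aut_group S\<^esub> h = (compose (points S) (fst g) (fst h), compose (lines S) (snd g) (snd h))"
  using assms by (auto simp: aut_group_def BijGroup_def DirProd_def automorphisms_def)

lemma one_aut_group:
  "\<one>\<^bsub>aut_group S\<^esub> = ((\<lambda>p\<in>points S. p), (\<lambda>l\<in>lines S. l))"
  by (simp add: aut_group_def BijGroup_def)

lemma group_hom_aut_group_fst: "group_hom (aut_group S) (BijGroup (points S)) fst"
  unfolding group_hom_def group_hom_axioms_def
  by (auto simp: hom_def mult_aut_group carrier_BijGroup group_aut_group group_BijGroup)
     (auto simp: automorphisms_def BijGroup_def)

lemma group_aut_stabilizer:
  assumes "x \<in> points S"
  shows "group (aut_stabilizer S x)"
proof -
  interpret group_action "aut_group S" "points S" fst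
    by (simp add: group_action_def group_hom_aut_group_fst)
  show ?thesis
    unfolding aut_stabilizer_def
    by (intro subgroup.subgroup_is_group stabilizer_subgroup group_aut_group assms)
qed

lemma carrier_aut_stabilizer:
  "carrier (aut_stabilizer S x) = {g \<in> automorphisms S. fst g x = x}"
  by (simp add: aut_stabilizer_def stabilizer_def)

lemma mult_aut_stabilizer:
  assumes "g \<in> carrier (aut_stabilizer S x)" "h \<in> carrier (aut_stabilizer S x)"
  shows "p \<in> points S \<Longrightarrow> fst (g \<otimes>\<^bsub>aut_stabilizer S x\<^esub> h) p = fst g (fst h p)"
    and "l \<in> lines S \<Longrightarrow> snd (g \<otimes>\<^bsub>aut_stabilizer S x\<^esub> h) l = snd g (snd h l)"
  using assms
  by (simp_all add: aut_stabilizer_def stabilizer_def mult_aut_group compose_def)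

lemma one_aut_stabilizer:
  "\<one>\<^bsub>aut_stabilizer S x\<^esub> = ((\<lambda>p\<in>points S. p), (\<lambda>l\<in>lines S. l))"
  by (simp add: aut_stabilizer_def one_aut_group)

text \<open>Reduces a permutation representation to the formulas of an action on \<open>E\<close>:
  bijectivity is automatic because the inverse element undoes the action. The restriction supplies
  the extensionality that \<open>Bij E\<close> demands.\<close>

lemma (in group) hom_BijGroupI:
  assumes closed: "\<And>g e. g \<in> carrier G \<Longrightarrow> e \<in> E \<Longrightarrow> act g e \<in> E"
    and one: "\<And>e. e \<in> E \<Longrightarrow> act \<one> e = e"
    and mult: "\<And>g h e. g \<in> carrier G \<Longrightarrow> h \<in> carrier G \<Longrightarrow> e \<in> E \<Longrightarrow> act (g \<otimes> h) e = act g (act h e)"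
  shows "(\<lambda>g. restrict (act g) E) \<in> hom G (BijGroup E)"
proof -
  have Bij: "restrict (act g) E \<in> Bij E" if g: "g \<in> carrier G" for g
  proof -
    have "act g (act (inv g) e) = e" "act (inv g) (act g e) = e" if "e \<in> E" for e
      using that g one mult by (metis inv_closed l_inv r_inv)+
    with g have "bij_betw (act g) E E"
      by (intro bij_betw_byWitness[where f' = "act (inv g)"]) (auto intro: closed)
    then show ?thesis
      by (simp add: Bij_def cong: bij_betw_cong)
  qed
  moreover have "restrict (act (g \<otimes> h)) E = compose E (restrict (act g) E) (restrict (act h) E)"
    if "g \<in> carrier G" "h \<in> carrier G" for g h
    using that by (auto simp: fun_eq_iff compose_def mult closed)
  ultimately show ?thesis
    by (auto simp: hom_def BijGroup_def)
qed

text \<open>Multiplication in \<open>aut_group D\<close> is componentwise, so two permutation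
  representations combine as soon as they jointly respect incidence.\<close>

lemma hom_aut_groupI:
  assumes "\<phi> \<in> hom G (BijGroup (points D))" "\<chi> \<in> hom G (BijGroup (lines D))"
    and "\<And>g p l. g \<in> carrier G \<Longrightarrow> p \<in> points D \<Longrightarrow> l \<in> lines D \<Longrightarrow>
      incident D (\<phi> g p) (\<chi> g l) \<longleftrightarrow> incident D p l"
  shows "(\<lambda>g. (\<phi> g, \<chi> g)) \<in> hom G (aut_group D)"
  using assms
  by (auto simp: hom_def carrier_BijGroup aut_group_def DirProd_def automorphisms_def Pi_iff)

section \<open>Symmetries about a point\<close>

context generalized_quadrangle
begin

lemma projection_unique:
  assumes "p \<in> points S" "l \<in> lines S" "\<not> incident S p l"
    and "q \<in> points S" "incident S q l" "m \<in> lines S" "incident S p m" "incident S q m"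
    and "r \<in> points S" "incident S r l" "n \<in> lines S" "incident S p n" "incident S r n"
  shows "q = r"
proof -
  have "(q, m) = (r, n)"
    by (rule ex1E[OF projection[OF assms(1-3)]]) (metis (no_types, lifting) assms(4-) case_prod_conv)
  then show ?thesis by simp
qed

text \<open>If \<open>p\<close> were off \<open>l\<close>, it would differ from \<open>a\<close> and
  \<open>b\<close>, so collinearity would give genuine joining lines and two projections of
  \<open>p\<close> to \<open>l\<close>.\<close>

lemma no_triangle:
  assumes "p \<in> points S" "a \<in> points S" "b \<in> points S" "l \<in> lines S"
    and "incident S a l" "incident S b l" "a \<noteq> b" "collinear S p a" "collinear S p b"
  shows "incident S p l"
proof (rule ccontr)
  assume p: "\<not> incident S p l"
  with assms obtain m n where "m \<in> lines S" "incident S p m" "incident S a m"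
      "n \<in> lines S" "incident S p n" "incident S b n"
    by (auto simp: collinear_def)
  with projection_unique[OF assms(1,4) p, of a m b n] assms show False
    by blast
qed

lemma obtain_projection:
  assumes "p \<in> points S" "l \<in> lines S"
  obtains q where "q \<in> points S" "incident S q l" "collinear S p q"
proof (cases "incident S p l")
  case True
  then show ?thesis using assms that[of p] by simp
next
  case False
  show ?thesis using projection[OF assms False] that by (auto simp: collinear_def)
qed

lemma obtain_line:
  assumes "p \<in> points S"
  obtains m where "m \<in> lines S" "incident S p m" "m \<noteq> l"
proof -
  have "\<not> {m \<in> lines S. incident S p m} \<subseteq> {l}"
  proof
    assume "{m \<in> lines S. incident S p m} \<subseteq> {l}"
    from card_mono[OF _ this] show False
      using lines_on_point[OF assms] order_pos by simp
  qed
  with that show ?thesis by blast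
qed

lemma obtain_point:
  assumes "l \<in> lines S" "2 \<le> s"
  obtains q where "q \<in> points S" "incident S q l" "q \<noteq> a" "q \<noteq> b"
proof -
  have "\<not> {q \<in> points S. incident S q l} \<subseteq> {a, b}"
  proof
    assume "{q \<in> points S. incident S q l} \<subseteq> {a, b}"
    from card_mono[OF _ this] have "s + 1 \<le> card {a, b}"
      using points_on_line[OF assms(1)] by simp
    also have "\<dots> \<le> 2" by (simp add: card_insert_if)
    finally show False using assms(2) by simp
  qed
  with that show ?thesis by blast
qed

section \<open>Fixed points and fixed lines of symmetries\<close>

lemma fixed_line:
  assumes "g \<in> automorphisms S" "l \<in> lines S"
    and "p \<in> points S" "q \<in> points S" "incident S p l" "incident S q l" "p \<noteq> q"
    and "fst g p = p" "fst g q = q"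
  shows "snd g l = l"
  using partial_linear[of p q "snd g l" l] assms
    automorphism_incident[OF assms(1), of p l] automorphism_incident[OF assms(1), of q l] by simp

text \<open>If \<open>y\<close> is not collinear with \<open>x\<close>, a second line through
  \<open>y\<close> carries a point \<open>p\<close> collinear with \<open>x\<close>, which is fixed
  and off \<open>l\<close>. Both \<open>y\<close> and its image are then the projection of
  \<open>p\<close> to the fixed line \<open>l\<close>.\<close>

lemma symmetry_fixes_points_of_fixed_line:
  assumes g: "is_symmetry S x g" and x: "x \<in> points S"
    and l: "l \<in> lines S" "\<not> incident S x l" "snd g l = l"
    and y: "y \<in> points S" "incident S y l"
  shows "fst g y = y"
proof (cases "collinear S y x")
  case True
  with g y show ?thesis by (simp add: is_symmetry_def perp_def)
next
  case False
  have g': "g \<in> automorphisms S" using g by (simp add: is_symmetry_def)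
  obtain m where m: "m \<in> lines S" "incident S y m" "m \<noteq> l"
    using obtain_line[OF y(1)] .
  obtain p where p: "p \<in> points S" "incident S p m" "collinear S x p"
    using obtain_projection[OF x m(1)] .
  have gp: "fst g p = p"
    using g p by (simp add: is_symmetry_def perp_def collinear_sym)
  have "p \<noteq> y" using p False by (auto simp: collinear_sym)
  then have "\<not> incident S p l"
    using partial_linear[of p y l m] p m l y by auto
  moreover have "incident S p (snd g m)" "incident S (fst g y) (snd g m)" "incident S (fst g y) l"
    using g' p m y l automorphism_incident[OF g', of p m] automorphism_incident[OF g', of y m]
      automorphism_incident[OF g', of y l] by (simp_all add: gp)
  ultimately show ?thesis
    using projection_unique[of p l "fst g y" "snd g m" y m] p m y l g' by auto
qed

text \<open>Fixed points and lines spread from \<open>z\<close>: first to the lines on \<open>z\<close> and their points, then to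
  the lines on a point \<open>v\<close> of \<open>x\<^sup>\<bottom>\<close> not collinear with \<open>z\<close>, since each of these carries besides
  \<open>v\<close> a point collinear with \<open>z\<close>.\<close>

lemma symmetry_fixes_far_line:
  assumes g: "is_symmetry S x g" and x: "x \<in> points S"
    and z: "z \<in> points S" "\<not> collinear S z x" "fst g z = z"
    and v: "v \<in> points S" "collinear S v x" "\<not> collinear S v z"
    and l: "l \<in> lines S" "\<not> incident S x l" "incident S v l"
    and y: "y \<in> points S" "incident S y l"
  shows "fst g y = y"
proof -
  have g': "g \<in> automorphisms S" using g by (simp add: is_symmetry_def)
  have near: "fst g p = p" if "p \<in> points S" "collinear S p x" for p
    using g that by (simp add: is_symmetry_def perp_def)
  obtain q where q: "q \<in> points S" "incident S q l" "collinear S z q"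
    using obtain_projection[OF z(1) l(1)] .
  have "q \<noteq> v" "q \<noteq> z"
    using q v l by (auto simp: collinear_sym) (auto simp: collinear_def)
  then obtain m where m: "m \<in> lines S" "incident S z m" "incident S q m"
    using q by (auto simp: collinear_def)
  then have xm: "\<not> incident S x m"
    using z by (auto simp: collinear_def)
  obtain u where u: "u \<in> points S" "incident S u m" "collinear S x u"
    using obtain_projection[OF x m(1)] .
  \<comment> \<open>The line \<open>m\<close> joins \<open>z\<close> to a point \<open>u\<close> of
    the perp of \<open>x\<close>, and both are fixed.\<close>
  have "snd g m = m"
    using u z m near by (intro fixed_line[OF g', of m u z]) (auto simp: collinear_sym)
  then have "fst g q = q"
    using symmetry_fixes_points_of_fixed_line[OF g x m(1) xm] q m by blast
  then have "snd g l = l"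
    using q v l near \<open>q \<noteq> v\<close> by (intro fixed_line[OF g', of l q v]) auto
  then show ?thesis
    using symmetry_fixes_points_of_fixed_line[OF g x l(1,2)] y by blast
qed

text \<open>A point \<open>w\<close> is fixed by the preceding lemma whenever its trace has a point
  \<open>v\<close> not collinear with \<open>z\<close>. If the trace of \<open>y\<close> has no such
  point, \<open>y\<close> is reached through a neighbour \<open>y'\<close> whose trace does.\<close>

lemma symmetry_fixing_far_point:
  assumes g: "is_symmetry S x g" and x: "x \<in> points S" and s: "2 \<le> s"
    and z: "z \<in> points S" "\<not> collinear S z x" "fst g z = z"
    and y: "y \<in> points S"
  shows "fst g y = y"
proof (cases "collinear S y x")
  case True
  with g y show ?thesis by (simp add: is_symmetry_def perp_def)
next
  case far: False
  have g': "g \<in> automorphisms S" using g by (simp add: is_symmetry_def)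
  have near: "fst g p = p" if "p \<in> points S" "collinear S p x" for p
    using g that by (simp add: is_symmetry_def perp_def)
  have *: "fst g w = w"
    if w: "w \<in> points S" "\<not> collinear S w x"
      "v \<in> points S" "collinear S v x" "collinear S v w" "\<not> collinear S v z" for v w
  proof -
    have "v \<noteq> w" using w by blast
    then obtain l where l: "l \<in> lines S" "incident S v l" "incident S w l"
      using w by (auto simp: collinear_def)
    then have "\<not> incident S x l" using w by (auto simp: collinear_def)
    with l w show ?thesis
      using symmetry_fixes_far_line[OF g x z] by blast
  qed
  show ?thesis
  proof (cases "\<exists>v\<in>points S. collinear S v x \<and> collinear S v y \<and> \<not> collinear S v z")
    case True
    with * y far show ?thesis by blast
  next
    case False
    txt \<open>Here \<open>y\<close> has the same trace as \<open>z\<close>; a further point \<open>y'\<close> on a line through \<open>y\<close> has another trace.\<close>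
    obtain l where l: "l \<in> lines S" "incident S y l" using obtain_line[OF y] .
    have xl: "\<not> incident S x l" using l far by (auto simp: collinear_def)
    obtain v where v: "v \<in> points S" "incident S v l" "collinear S x v"
      using obtain_projection[OF x l(1)] .
    obtain m where m: "m \<in> lines S" "incident S y m" "m \<noteq> l" using obtain_line[OF y] .
    obtain a where a: "a \<in> points S" "incident S a m" "collinear S x a"
      using obtain_projection[OF x m(1)] .
    have "collinear S a y" using a m by (auto simp: collinear_def)
    with False a have az: "collinear S a z" by (auto simp: collinear_sym)
    have ay: "a \<noteq> y" using a far by (auto simp: collinear_sym)
    \<comment> \<open>A third point of \<open>l\<close> besides \<open>y\<close> and
      \<open>v\<close>; this is where \<open>2 \<le> s\<close> enters.\<close>
    obtain y' where y': "y' \<in> points S" "incident S y' l" "y' \<noteq> v" "y' \<noteq> y"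
      using obtain_point[OF l(1) s] .
    have far': "\<not> collinear S y' x"
      using no_triangle[of x y' v l] x y' v l xl by (auto simp: collinear_sym)
    have ay': "\<not> collinear S a y'"
    proof
      assume "collinear S a y'"
      then have "incident S a l"
        using no_triangle[of a y' y l] a y y' l \<open>collinear S a y\<close> by auto
      then show False using partial_linear[of a y l m] a y l m ay by auto
    qed
    have "a \<noteq> x" using \<open>collinear S a y\<close> far by (auto simp: collinear_sym)
    \<comment> \<open>The point of the trace of \<open>y'\<close> on the line \<open>n\<close>
      joining \<open>x\<close> and \<open>a\<close> will witness that this trace is not that of
      \<open>z\<close>.\<close>
    then obtain n where n: "n \<in> lines S" "incident S x n" "incident S a n"
      using a by (auto simp: collinear_def)
    obtain a' where a': "a' \<in> points S" "incident S a' n" "collinear S y' a'"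
      using obtain_projection[OF y'(1) n(1)] .
    have "a' \<noteq> a" using a' ay' by (auto simp: collinear_sym)
    have "collinear S a' x" using a' n by (auto simp: collinear_def)
    \<comment> \<open>As \<open>z\<close> is collinear with \<open>a\<close>, collinearity with a
      second point \<open>a'\<close> of \<open>n\<close> would put \<open>z\<close> on
      \<open>n\<close>, a line through \<open>x\<close>.\<close>
    moreover have "\<not> collinear S a' z"
      using no_triangle[of z a a' n] z a a' n az \<open>a' \<noteq> a\<close>
      by (auto simp: collinear_sym) (auto simp: collinear_def)
    ultimately have "fst g y' = y'"
      using *[of y' a'] y' far' a' by (auto simp: collinear_sym)
    then have "snd g l = l"
      using y' v l near by (intro fixed_line[OF g', of l y' v]) (auto simp: collinear_sym)
    then show ?thesis
      using symmetry_fixes_points_of_fixed_line[OF g x l(1) xl] y l by blast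
  qed
qed

text \<open>Each line carries two fixed points and is therefore fixed. Equality of the pairs of
  functions then follows from extensionality of elements of \<open>Bij\<close>.\<close>

lemma automorphism_eq_one:
  assumes g: "g \<in> automorphisms S" and s: "2 \<le> s" and fixed: "\<And>p. p \<in> points S \<Longrightarrow> fst g p = p"
  shows "g = \<one>\<^bsub>aut_group S\<^esub>"
proof -
  have "snd g l = l" if l: "l \<in> lines S" for l
  proof -
    obtain p where p: "p \<in> points S" "incident S p l" using obtain_point[OF l s] .
    obtain q where q: "q \<in> points S" "incident S q l" "q \<noteq> p" using obtain_point[OF l s] .
    with p show ?thesis using fixed_line[OF g l] fixed by blast
  qed
  then show ?thesis
    using g fixed unfolding one_aut_group
    by (cases g) (auto simp: automorphisms_def Bij_def extensional_def fun_eq_iff)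
qed

end

section \<open>Membership and incidence in the derived quadrangle and the plane\<close>

lemma points_payne_derived [simp]:
  "points (payne_derived S x) = {y \<in> points S. \<not> collinear S y x}"
  by (simp add: payne_derived_def)

lemma line_payne_derived_simps [simp]:
  "Inl l \<in> lines (payne_derived S x) \<longleftrightarrow> l \<in> lines S \<and> \<not> incident S x l"
  "Inr B \<in> lines (payne_derived S x) \<longleftrightarrow>
    (\<exists>r\<in>points (payne_derived S x). B = perp S (perp S {x, r}) - {x})"
  by (auto simp: payne_derived_def)

lemma incident_payne_derived [simp]:
  "incident (payne_derived S x) p (Inl l) \<longleftrightarrow> incident S p l"
  "incident (payne_derived S x) p (Inr B) \<longleftrightarrow> p \<in> B"
  by (simp_all add: payne_derived_def)

lemma points_affine_plane_at:
  "points (affine_plane_at S x) = (\<lambda>z. perp S {x, z}) ` points (payne_derived S x)"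
  by (auto simp: affine_plane_at_def)

lemma lines_affine_plane_at: "lines (affine_plane_at S x) = perp S {x} - {x}"
  by (simp add: affine_plane_at_def)

section \<open>The actions of the stabilizer of a point\<close>

locale point_stabilizer =
  fixes S :: "('p, 'l) incidence_structure" and x :: 'p
  assumes center: "x \<in> points S"

sublocale point_stabilizer \<subseteq> group "aut_stabilizer S x"
  using center by (rule group_aut_stabilizer)

context point_stabilizer
begin

abbreviation "T \<equiv> aut_stabilizer S x"

lemma stabilizerD:
  assumes "g \<in> carrier T"
  shows "g \<in> automorphisms S" "fst g x = x"
  using assms by (auto simp: carrier_aut_stabilizer)

text \<open>The group inverse is given only abstractly; evaluating its products with
  \<open>g\<close> at \<open>p\<close> yields the pointwise cancellation laws.\<close>

lemma inv_stabilizer_point: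
  assumes "g \<in> carrier T" "p \<in> points S"
  shows "fst (inv\<^bsub>T\<^esub> g) (fst g p) = p" "fst g (fst (inv\<^bsub>T\<^esub> g) p) = p"
proof -
  have "fst (inv\<^bsub>T\<^esub> g \<otimes>\<^bsub>T\<^esub> g) p = p" "fst (g \<otimes>\<^bsub>T\<^esub> inv\<^bsub>T\<^esub> g) p = p"
    using assms by (simp_all add: one_aut_stabilizer)
  then show "fst (inv\<^bsub>T\<^esub> g) (fst g p) = p" "fst g (fst (inv\<^bsub>T\<^esub> g) p) = p"
    using assms mult_aut_stabilizer(1)[of g S x "inv\<^bsub>T\<^esub> g" p]
      mult_aut_stabilizer(1)[of "inv\<^bsub>T\<^esub> g" S x g p] by simp_all
qed

lemma stabilizer_inj_on:
  assumes "g \<in> carrier T"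
  shows "inj_on (fst g) (points S)"
  using automorphism_bij(1)[OF stabilizerD(1)[OF assms]] by (simp add: bij_betw_def)

lemma stabilizer_mem_image_iff:
  assumes "g \<in> carrier T" "B \<subseteq> points S" "p \<in> points S"
  shows "fst g p \<in> fst g ` B \<longleftrightarrow> p \<in> B"
  using stabilizer_inj_on[OF assms(1)] assms by (simp add: inj_on_image_mem_iff)

text \<open>Multiplication is composition restricted to \<open>points S\<close>, so the product law
  for images requires \<open>B\<close> to consist of points.\<close>

lemma stabilizer_mult_image:
  assumes "g \<in> carrier T" "h \<in> carrier T" "B \<subseteq> points S"
  shows "fst (g \<otimes>\<^bsub>T\<^esub> h) ` B = fst g ` fst h ` B"
  unfolding image_image using assms
  by (intro image_cong) (auto simp: mult_aut_stabilizer(1))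

lemma stabilizer_one_image:
  assumes "B \<subseteq> points S"
  shows "fst \<one>\<^bsub>T\<^esub> ` B = B"
proof -
  have "fst \<one>\<^bsub>T\<^esub> ` B = (\<lambda>p. p) ` B"
    using assms by (intro image_cong) (auto simp: one_aut_stabilizer)
  then show ?thesis by simp
qed

lemma stabilizer_collinear_center [simp]:
  assumes "g \<in> carrier T" "p \<in> points S"
  shows "collinear S (fst g p) x \<longleftrightarrow> collinear S p x"
  using automorphism_collinear[OF stabilizerD(1)[OF assms(1)] assms(2) center]
  by (simp add: stabilizerD[OF assms(1)])

lemma stabilizer_incident_center [simp]:
  assumes "g \<in> carrier T" "l \<in> lines S"
  shows "incident S x (snd g l) \<longleftrightarrow> incident S x l"
  using automorphism_incident[OF stabilizerD(1)[OF assms(1)] center assms(2)]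
  by (simp add: stabilizerD[OF assms(1)])

lemma stabilizer_perp:
  assumes g: "g \<in> carrier T" and z: "z \<in> points S"
  shows "fst g ` perp S {x, z} = perp S {x, fst g z}"
  using automorphism_perp[OF stabilizerD(1)[OF g], of "{x, z}"] center z
  by (simp add: stabilizerD[OF g])

lemma stabilizer_span:
  assumes g: "g \<in> carrier T" and z: "z \<in> points S"
  shows "fst g ` (perp S (perp S {x, z}) - {x}) = perp S (perp S {x, fst g z}) - {x}"
proof -
  \<comment> \<open>Injectivity lets the image pass through the set difference, and \<open>x\<close>
    itself is fixed.\<close>
  have "fst g ` (perp S (perp S {x, z}) - {x}) = fst g ` perp S (perp S {x, z}) - fst g ` {x}"
    by (rule inj_on_image_set_diff[OF stabilizer_inj_on[OF g]])
      (use center perp_subset[of S "perp S {x, z}"] in blast)+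
  then show ?thesis
    using automorphism_perp[OF stabilizerD(1)[OF g] perp_subset, of "{x, z}"]
    by (simp add: stabilizer_perp[OF g z] stabilizerD[OF g])
qed

lemma stabilizer_line_payne:
  assumes g: "g \<in> carrier T" and m: "m \<in> lines (payne_derived S x)"
  shows "map_sum (snd g) (image (fst g)) m \<in> lines (payne_derived S x)"
proof (cases m)
  case (Inl l)
  with assms stabilizerD[OF g] show ?thesis by simp
next
  case (Inr B)
  with m obtain r where r: "r \<in> points (payne_derived S x)" "B = perp S (perp S {x, r}) - {x}"
    by (auto simp del: points_payne_derived)
  then have "fst g r \<in> points (payne_derived S x)"
      "fst g ` B = perp S (perp S {x, fst g r}) - {x}"
    using g stabilizerD[OF g] by (simp_all add: stabilizer_span)
  with Inr show ?thesis by (auto simp del: points_payne_derived)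
qed

lemma payne_line_subset:
  assumes "Inr B \<in> lines (payne_derived S x)"
  shows "B \<subseteq> points S"
proof -
  obtain r where "B = perp S (perp S {x, r}) - {x}"
    using assms by auto
  then show ?thesis using perp_subset[of S "perp S {x, r}"] by blast
qed

lemma plane_point_subset: "A \<in> points (affine_plane_at S x) \<Longrightarrow> A \<subseteq> points S"
  unfolding points_affine_plane_at by (elim imageE) simp

text \<open>Lines of \<open>S\<close> off \<open>x\<close> stay off \<open>x\<close>, and spans go
  to spans because \<open>x\<close> is fixed. Incidence with an \<open>Inr\<close> line is
  membership, which injectivity on points preserves.\<close>

lemma payne_action_hom: "payne_action S x \<in> hom T (aut_group (payne_derived S x))"
  unfolding payne_action_def
proof (intro hom_aut_groupI hom_BijGroupI)
  fix g h p assume "g \<in> carrier T" "h \<in> carrier T" "p \<in> points (payne_derived S x)"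
  then show "fst (g \<otimes>\<^bsub>T\<^esub> h) p = fst g (fst h p)"
    by (simp add: mult_aut_stabilizer)
next
  fix g h m assume gh: "g \<in> carrier T" "h \<in> carrier T" and m: "m \<in> lines (payne_derived S x)"
  show "map_sum (snd (g \<otimes>\<^bsub>T\<^esub> h)) (image (fst (g \<otimes>\<^bsub>T\<^esub> h))) m =
      map_sum (snd g) (image (fst g)) (map_sum (snd h) (image (fst h)) m)"
  proof (cases m)
    case (Inl l)
    with m gh show ?thesis by (simp add: mult_aut_stabilizer)
  next
    case (Inr B)
    with m have "B \<subseteq> points S" by (intro payne_line_subset) blast
    with Inr gh show ?thesis by (simp add: stabilizer_mult_image)
  qed
next
  fix m assume m: "m \<in> lines (payne_derived S x)"
  show "map_sum (snd \<one>\<^bsub>T\<^esub>) (image (fst \<one>\<^bsub>T\<^esub>)) m = m"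
  proof (cases m)
    case (Inl l)
    with m show ?thesis by (simp add: one_aut_stabilizer)
  next
    case (Inr B)
    with m have "B \<subseteq> points S" by (intro payne_line_subset) blast
    with Inr show ?thesis by (simp add: stabilizer_one_image)
  qed
next
  fix g p m assume g: "g \<in> carrier T" and p: "p \<in> points (payne_derived S x)"
    and m: "m \<in> lines (payne_derived S x)"
  show "incident (payne_derived S x) (restrict (fst g) (points (payne_derived S x)) p)
      (restrict (map_sum (snd g) (image (fst g))) (lines (payne_derived S x)) m) \<longleftrightarrow>
      incident (payne_derived S x) p m"
  proof (cases m)
    case (Inl l)
    with m p stabilizerD[OF g] show ?thesis by simp
  next
    case (Inr B)
    with m have "B \<subseteq> points S" by (intro payne_line_subset) blast
    with p have "fst g p \<in> fst g ` B \<longleftrightarrow> p \<in> B"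
      by (simp add: stabilizer_mem_image_iff g)
    with Inr m p show ?thesis by (simp del: points_payne_derived line_payne_derived_simps)
  qed
next
  fix g p assume "g \<in> carrier T" "p \<in> points (payne_derived S x)"
  then show "fst g p \<in> points (payne_derived S x)"
    by (simp add: stabilizerD)
next
  fix p assume "p \<in> points (payne_derived S x)"
  then show "fst \<one>\<^bsub>T\<^esub> p = p"
    by (simp add: one_aut_stabilizer)
qed (rule stabilizer_line_payne)

lemma stabilizer_perp_center:
  assumes "g \<in> carrier T" "p \<in> perp S {x} - {x}"
  shows "fst g p \<in> perp S {x} - {x}"
  using assms automorphism_point_eq[OF stabilizerD(1)[OF assms(1)], of p x] center
  by (auto simp: perp_def stabilizerD)

lemma plane_action_hom: "plane_action S x \<in> hom T (aut_group (affine_plane_at S x))"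
  unfolding plane_action_def
proof (intro hom_aut_groupI hom_BijGroupI)
  fix g A assume "g \<in> carrier T" "A \<in> points (affine_plane_at S x)"
  then show "fst g ` A \<in> points (affine_plane_at S x)"
    by (auto simp: points_affine_plane_at stabilizer_perp stabilizerD)
next
  fix A assume "A \<in> points (affine_plane_at S x)"
  then show "fst \<one>\<^bsub>T\<^esub> ` A = A"
    by (simp add: plane_point_subset stabilizer_one_image)
next
  fix g h A assume gh: "g \<in> carrier T" "h \<in> carrier T" and "A \<in> points (affine_plane_at S x)"
  then show "fst (g \<otimes>\<^bsub>T\<^esub> h) ` A = fst g ` fst h ` A"
    using gh by (simp add: plane_point_subset stabilizer_mult_image)
next
  fix g A p assume g: "g \<in> carrier T" and A: "A \<in> points (affine_plane_at S x)"
    and p: "p \<in> lines (affine_plane_at S x)"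
  have "A \<subseteq> points S" "p \<in> points S"
    using A p by (simp_all add: plane_point_subset lines_affine_plane_at perp_def)
  then have "fst g p \<in> fst g ` A \<longleftrightarrow> p \<in> A"
    by (simp add: stabilizer_mem_image_iff g)
  with A p show "incident (affine_plane_at S x)
      (restrict (image (fst g)) (points (affine_plane_at S x)) A)
      (restrict (fst g) (lines (affine_plane_at S x)) p) \<longleftrightarrow> incident (affine_plane_at S x) A p"
    by (simp add: affine_plane_at_def)
next
  fix g p assume "g \<in> carrier T" "p \<in> lines (affine_plane_at S x)"
  then show "fst g p \<in> lines (affine_plane_at S x)"
    using stabilizer_perp_center by (simp add: lines_affine_plane_at)
next
  fix p assume "p \<in> lines (affine_plane_at S x)"
  then show "fst \<one>\<^bsub>T\<^esub> p = p"
    by (simp add: lines_affine_plane_at one_aut_stabilizer perp_def)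
next
  fix g h p assume "g \<in> carrier T" "h \<in> carrier T" "p \<in> lines (affine_plane_at S x)"
  then show "fst (g \<otimes>\<^bsub>T\<^esub> h) p = fst g (fst h p)"
    by (simp add: lines_affine_plane_at mult_aut_stabilizer perp_def)
qed

lemma fst_plane_action:
  assumes "g \<in> carrier T" "z \<in> points (payne_derived S x)"
  shows "fst (plane_action S x g) (perp S {x, z}) = perp S {x, fst g z}"
  using assms by (simp add: plane_action_def points_affine_plane_at stabilizer_perp)

lemma fst_payne_action:
  "z \<in> points (payne_derived S x) \<Longrightarrow> fst (payne_action S x g) z = fst g z"
  by (simp add: payne_action_def)

end

sublocale point_stabilizer \<subseteq> payne: group_hom T "aut_group (payne_derived S x)" "payne_action S x"
  by (intro group_hom.intro group_hom_axioms.intro is_group group_aut_group payne_action_hom)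

sublocale point_stabilizer \<subseteq> plane: group_hom T "aut_group (affine_plane_at S x)" "plane_action S x"
  by (intro group_hom.intro group_hom_axioms.intro is_group group_aut_group plane_action_hom)

section \<open>Groups of symmetries of maximal order\<close>

text \<open>Collects the hypotheses of the theorem; thickness enters as
  \<open>2 \<le> s\<close>.\<close>

locale full_symmetry_group =
  generalized_quadrangle S s s + point_stabilizer S x
  for S :: "('p, 'l) incidence_structure" and s and x +
  fixes SS :: "(('p \<Rightarrow> 'p) \<times> ('l \<Rightarrow> 'l)) set"
  assumes order_ge_2: "2 \<le> s"
    and regular: "regular_point S s x"
    and SS_subgroup: "subgroup SS T"
    and card_SS: "card SS = s"
    and SS_symmetry: "g \<in> SS \<Longrightarrow> is_symmetry S x g"
begin

text \<open>Prepares a recurring argument: two elements coincide once their quotient is a symmetry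
  fixing a point not collinear with \<open>x\<close>.\<close>

lemma eq_if_inv_mult_eq_one:
  assumes "g \<in> carrier T" "h \<in> carrier T" "inv\<^bsub>T\<^esub> h \<otimes>\<^bsub>T\<^esub> g = \<one>\<^bsub>T\<^esub>"
  shows "g = h"
proof -
  have "inv\<^bsub>T\<^esub> g = inv\<^bsub>T\<^esub> h"
    using assms by (intro inv_equality inv_closed)
  then have "inv\<^bsub>T\<^esub> (inv\<^bsub>T\<^esub> g) = inv\<^bsub>T\<^esub> (inv\<^bsub>T\<^esub> h)" by simp
  with assms show ?thesis by (simp only: inv_inv)
qed

section \<open>Orbits of \<open>SS\<close> and fibres of the trace map\<close>

lemma SS_carrier: "g \<in> SS \<Longrightarrow> g \<in> carrier T"
  using subgroup.subset[OF SS_subgroup] by blast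

lemma symmetry_eq_one:
  assumes "is_symmetry S x g" and "z \<in> points (payne_derived S x)" "fst g z = z"
  shows "g = \<one>\<^bsub>T\<^esub>"
proof -
  have "g = \<one>\<^bsub>aut_group S\<^esub>"
    using assms symmetry_fixing_far_point[OF assms(1) center order_ge_2, of z]
    by (intro automorphism_eq_one order_ge_2) (auto simp: is_symmetry_def)
  then show ?thesis
    by (simp add: one_aut_group one_aut_stabilizer)
qed

text \<open>The trace of \<open>z\<close> lies in the perp of \<open>x\<close>, hence is fixed
  pointwise; as an automorphism fixing \<open>x\<close>, \<open>g\<close> also carries it to the
  trace of the image of \<open>z\<close>.\<close>

lemma SS_trace:
  assumes g: "g \<in> SS" and z: "z \<in> points (payne_derived S x)"
  shows "perp S {x, fst g z} = perp S {x, z}"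
proof -
  have "fst g ` perp S {x, z} = (\<lambda>p. p) ` perp S {x, z}"
    using SS_symmetry[OF g] by (intro image_cong) (auto simp: is_symmetry_def perp_def)
  then show ?thesis
    using stabilizer_perp[OF SS_carrier[OF g], of z] z by simp
qed

text \<open>The orbit of \<open>z\<close> has \<open>s\<close> points, all with the trace of \<open>z\<close>, and by regularity
  there are at most \<open>s\<close> such points.\<close>

lemma SS_transitive_on_trace:
  assumes z: "z \<in> points (payne_derived S x)" and w: "w \<in> points (payne_derived S x)"
    and trace: "perp S {x, w} = perp S {x, z}"
  shows "\<exists>n\<in>SS. fst n z = w"
proof -
  let ?W = "{y \<in> points (payne_derived S x). perp S {x, y} = perp S {x, z}}"
  let ?B = "perp S (perp S {x, z})"
  \<comment> \<open>If \<open>n\<close> and \<open>m\<close> agree at \<open>z\<close>, their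
    quotient is a symmetry fixing \<open>z\<close>, hence trivial. So the orbit of \<open>z\<close>
    has exactly \<open>s\<close> points.\<close>
  have inj: "inj_on (\<lambda>n. fst n z) SS"
  proof (rule inj_onI)
    fix n m assume nm: "n \<in> SS" "m \<in> SS" "fst n z = fst m z"
    have c: "n \<in> carrier T" "m \<in> carrier T" using nm SS_carrier by auto
    have mem: "inv\<^bsub>T\<^esub> m \<otimes>\<^bsub>T\<^esub> n \<in> SS"
      using nm SS_subgroup by (simp add: subgroup.m_closed subgroup.m_inv_closed)
    have "fst (inv\<^bsub>T\<^esub> m \<otimes>\<^bsub>T\<^esub> n) z = z"
      using nm c z inv_stabilizer_point(1)[OF c(2), of z]
      by (simp add: mult_aut_stabilizer(1)[OF inv_closed])
    then have "inv\<^bsub>T\<^esub> m \<otimes>\<^bsub>T\<^esub> n = \<one>\<^bsub>T\<^esub>"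
      using symmetry_eq_one[OF SS_symmetry[OF mem] z] by blast
    then show "n = m"
      using eq_if_inv_mult_eq_one c by blast
  qed
  have card_B: "card ?B = s + 1"
    using regular z by (simp add: regular_point_def)
  then have fin: "finite ?B" by (intro card_ge_0_finite) simp
  have xB: "x \<in> ?B"
    using center by (auto simp: perp_def collinear_sym)
  \<comment> \<open>A point with the trace of \<open>z\<close> is collinear with all of that trace,
    so it lies in the double perp. Removing \<open>x\<close> from its \<open>s + 1\<close> points
    leaves the bound \<open>s\<close>.\<close>
  have WB: "?W \<subseteq> ?B - {x}"
  proof
    fix y assume "y \<in> ?W"
    then have y: "y \<in> points S" "\<not> collinear S y x" "perp S {x, y} = perp S {x, z}"
      by simp_all
    have "collinear S y a" if "a \<in> perp S {x, z}" for a
      using that unfolding y(3)[symmetric] by (simp add: perp_def collinear_sym)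
    moreover have "y \<noteq> x" using y(2) by auto
    ultimately show "y \<in> ?B - {x}" using y(1) by (simp add: perp_def[of S "perp S {x, z}"])
  qed
  have fin_W: "finite ?W"
    using finite_subset[OF WB finite_Diff[OF fin]] .
  have "card ?W \<le> card (?B - {x})"
    using card_mono[OF finite_Diff[OF fin] WB] .
  then have "card ?W \<le> card ((\<lambda>n. fst n z) ` SS)"
    using card_image[OF inj] card_SS card_B xB fin by simp
  moreover have "(\<lambda>n. fst n z) ` SS \<subseteq> ?W"
  proof (rule image_subsetI)
    fix n assume n: "n \<in> SS"
    then show "fst n z \<in> ?W"
      using SS_trace[OF n z] z SS_carrier[OF n] by (simp add: stabilizerD)
  qed
  ultimately have "(\<lambda>n. fst n z) ` SS = ?W"
    by (intro card_seteq[OF fin_W])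
  moreover have "w \<in> ?W" using w trace by simp
  ultimately have "w \<in> (\<lambda>n. fst n z) ` SS" by blast
  then show ?thesis by auto
qed

text \<open>The image of \<open>z\<close> under \<open>g\<close> has the trace of \<open>z\<close>,
  so some \<open>n\<close> in \<open>SS\<close> agrees with \<open>g\<close> at \<open>z\<close>;
  the quotient is a symmetry fixing \<open>z\<close> and thus trivial.\<close>

lemma symmetry_in_SS:
  assumes z: "z \<in> points (payne_derived S x)" and g: "is_symmetry S x g"
  shows "g \<in> SS"
proof -
  have "x \<in> perp S {x}" using center by (simp add: perp_def)
  with g have c: "g \<in> carrier T" by (simp add: carrier_aut_stabilizer is_symmetry_def)
  have "fst g ` perp S {x, z} = (\<lambda>p. p) ` perp S {x, z}"
    using g by (intro image_cong) (auto simp: is_symmetry_def perp_def)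
  then have "perp S {x, fst g z} = perp S {x, z}"
    using stabilizer_perp[OF c, of z] z by simp
  moreover have "fst g z \<in> points (payne_derived S x)"
    using z c by (simp add: stabilizerD)
  ultimately obtain n where n: "n \<in> SS" "fst n z = fst g z"
    using SS_transitive_on_trace z by blast
  have nc: "n \<in> carrier T" using n SS_carrier by blast
  let ?h = "inv\<^bsub>T\<^esub> n \<otimes>\<^bsub>T\<^esub> g"
  have "fst ?h p = p" if "p \<in> perp S {x}" for p
  proof -
    have p: "p \<in> points S" "fst g p = p" "fst n p = p"
      using that g SS_symmetry[OF n(1)] by (auto simp: is_symmetry_def perp_def)
    then show ?thesis
      using inv_stabilizer_point(1)[OF nc p(1)] c nc by (simp add: mult_aut_stabilizer(1)[OF inv_closed])
  qed
  then have "is_symmetry S x ?h"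
    using c nc stabilizerD(1)[of ?h] by (simp add: is_symmetry_def)
  moreover have "fst ?h z = z"
    using inv_stabilizer_point(1)[OF nc, of z] c nc n z by (simp add: mult_aut_stabilizer(1)[OF inv_closed])
  ultimately have "?h = \<one>\<^bsub>T\<^esub>" using symmetry_eq_one z by blast
  then have "g = n" using eq_if_inv_mult_eq_one c nc by blast
  with n show ?thesis by simp
qed

section \<open>Kernels of the two actions\<close>

lemma obtain_far_point:
  obtains z where "z \<in> points (payne_derived S x)"
proof -
  obtain l where l: "l \<in> lines S" "incident S x l"
    using obtain_line[OF center] .
  obtain a where a: "a \<in> points S" "incident S a l" "a \<noteq> x"
    using obtain_point[OF l(1) order_ge_2] .
  obtain m where m: "m \<in> lines S" "incident S a m" "m \<noteq> l"
    using obtain_line[OF a(1)] .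
  obtain z where z: "z \<in> points S" "incident S z m" "z \<noteq> a"
    using obtain_point[OF m(1) order_ge_2] .
  have "collinear S x a" using a l by (auto simp: collinear_def)
  moreover have "\<not> incident S x m"
    using partial_linear[of x a l m] center a l m by blast
  \<comment> \<open>Otherwise \<open>x\<close>, \<open>a\<close> and \<open>z\<close> would form a
    triangle.\<close>
  ultimately have "\<not> collinear S z x"
    using no_triangle[of x a z m] center a m z by (auto simp: collinear_sym)
  with z that show thesis by simp
qed

text \<open>The lines of the plane are the points of the perp of \<open>x\<close> other than
  \<open>x\<close>, so acting trivially on them already means being a symmetry. Conversely, elements
  of \<open>SS\<close> preserve traces, the points of the plane.\<close>

lemma plane_action_eq_one_iff:
  assumes g: "g \<in> carrier T"
  shows "plane_action S x g = \<one>\<^bsub>aut_group (affine_plane_at S x)\<^esub> \<longleftrightarrow> g \<in> SS"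
proof
  assume "plane_action S x g = \<one>\<^bsub>aut_group (affine_plane_at S x)\<^esub>"
  then have "snd (plane_action S x g) p = p" if "p \<in> perp S {x} - {x}" for p
    using that by (simp add: one_aut_group lines_affine_plane_at)
  then have "fst g p = p" if "p \<in> perp S {x} - {x}" for p
    using that by (simp add: plane_action_def lines_affine_plane_at)
  then have "is_symmetry S x g"
    using stabilizerD[OF g] by (auto simp: is_symmetry_def)
  then show "g \<in> SS" using symmetry_in_SS obtain_far_point by blast
next
  assume gS: "g \<in> SS"
  then have "restrict (fst g) (lines (affine_plane_at S x)) = (\<lambda>l\<in>lines (affine_plane_at S x). l)"
    using SS_symmetry by (intro restrict_ext) (auto simp: is_symmetry_def lines_affine_plane_at)
  moreover have "restrict (image (fst g)) (points (affine_plane_at S x)) =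
      (\<lambda>A\<in>points (affine_plane_at S x). A)"
    using SS_trace[OF gS] stabilizer_perp[OF g]
    by (intro restrict_ext) (fastforce simp: points_affine_plane_at)
  ultimately show "plane_action S x g = \<one>\<^bsub>aut_group (affine_plane_at S x)\<^esub>"
    by (simp add: plane_action_def one_aut_group)
qed

text \<open>A kernel element fixes all lines off \<open>x\<close>. A point \<open>p\<close> other
  than \<open>x\<close> but collinear with it lies on such a line and is its only point collinear
  with \<open>x\<close>, so \<open>p\<close> is fixed as well; the element is a symmetry that also
  fixes points not collinear with \<open>x\<close>.\<close>

lemma payne_action_inj: "inj_on (payne_action S x) (carrier T)"
  unfolding payne.inj_on_one_iff
proof (intro allI impI)
  fix g assume g: "g \<in> carrier T"
    and one: "payne_action S x g = \<one>\<^bsub>aut_group (payne_derived S x)\<^esub>"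
  have far: "fst g p = p" if "p \<in> points (payne_derived S x)" for p
    using that fst_payne_action[OF that, of g] by (simp add: one one_aut_group)
  have line: "snd g l = l" if "l \<in> lines S" "\<not> incident S x l" for l
  proof -
    have "snd (payne_action S x g) (Inl l) = Inl l"
      using that by (simp add: one one_aut_group)
    with that show ?thesis by (simp add: payne_action_def)
  qed
  have "fst g p = p" if p: "p \<in> points S" "collinear S p x" for p
  proof (cases "p = x")
    case True
    then show ?thesis using stabilizerD[OF g] by simp
  next
    case False
    with p obtain k where k: "k \<in> lines S" "incident S p k" "incident S x k"
      by (auto simp: collinear_def)
    obtain l where l: "l \<in> lines S" "incident S p l" "l \<noteq> k"
      using obtain_line[OF p(1)] .
    have xl: "\<not> incident S x l"
      using partial_linear[of p x k l] p k l center False by blast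
    have "incident S (fst g p) l"
      using automorphism_incident[OF stabilizerD(1)[OF g] p(1) l(1)] l line[OF l(1) xl] by simp
    moreover have "collinear S (fst g p) x" using g p by simp
    ultimately show ?thesis
      using no_triangle[of x "fst g p" p l] p l xl center stabilizerD[OF g]
      by (auto simp: collinear_sym)
  qed
  then have "is_symmetry S x g"
    using stabilizerD[OF g] by (simp add: is_symmetry_def perp_def)
  then show "g = \<one>\<^bsub>T\<^esub>"
    using symmetry_eq_one obtain_far_point far by blast
qed

section \<open>Passing between the derived quadrangle and the plane\<close>

lemma eq_if_plane_action_eq:
  assumes gh: "g \<in> carrier T" "h \<in> carrier T"
    and plane: "plane_action S x g = plane_action S x h"
    and z: "z \<in> points (payne_derived S x)" "fst g z = fst h z"
  shows "g = h"
proof -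
  let ?k = "inv\<^bsub>T\<^esub> h \<otimes>\<^bsub>T\<^esub> g"
  \<comment> \<open>The quotient \<open>?k\<close> lies in the kernel \<open>SS\<close> and fixes
    \<open>z\<close>, which forces it to be trivial.\<close>
  have "plane_action S x ?k = \<one>\<^bsub>aut_group (affine_plane_at S x)\<^esub>"
    using gh plane by (simp add: plane.H.l_inv del: carrier_aut_group)
  then have "?k \<in> SS" using plane_action_eq_one_iff[of ?k] gh by simp
  moreover have "fst ?k z = z"
    using gh z inv_stabilizer_point(1)[OF gh(2), of z]
    by (simp add: mult_aut_stabilizer(1)[OF inv_closed])
  ultimately have "?k = \<one>\<^bsub>T\<^esub>" using symmetry_eq_one[OF SS_symmetry z(1)] by blast
  then show "g = h" using eq_if_inv_mult_eq_one gh by blast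
qed

text \<open>As \<open>SS\<close> is the kernel of the plane action, the first isomorphism theorem
  gives normality and the faithful action of the quotient. Transitivity descends along the trace
  map; for uniqueness, \<open>SS\<close> corrects two elements with the same effect on a trace until
  they agree at a point above it.\<close>

lemma singer_group_induces_plane_group:
  assumes singer: "singer_group (payne_derived S x) (payne_action S x ` H)"
    and H: "subgroup H T" and SS_H: "SS \<subseteq> H"
  shows "SS \<lhd> T\<lparr>carrier := H\<rparr> \<and>
    (\<exists>\<psi>. \<psi> \<in> hom (T\<lparr>carrier := H\<rparr> Mod SS) (aut_group (affine_plane_at S x)) \<and>
       (\<forall>g\<in>H. \<psi> (SS #>\<^bsub>T\<^esub> g) = plane_action S x g) \<and>
       inj_on \<psi> (carrier (T\<lparr>carrier := H\<rparr> Mod SS)) \<and>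
       sharply_transitive (carrier (T\<lparr>carrier := H\<rparr> Mod SS))
         (\<lambda>C. fst (\<psi> C)) (points (affine_plane_at S x)))"
proof -
  let ?H = "T\<lparr>carrier := H\<rparr>"
  let ?far = "points (payne_derived S x)"
  \<comment> \<open>The plane action is constant on cosets of its kernel, so \<open>the_elem\<close>
    extracts the single value.\<close>
  define \<psi> where "\<psi> = (\<lambda>C. the_elem (plane_action S x ` C))"
  have HT: "g \<in> carrier T" if "g \<in> H" for g
    using that subgroup.subset[OF H] by blast
  interpret plane_H: group_hom ?H "aut_group (affine_plane_at S x)" "plane_action S x"
    using plane_action_hom HT
    by (intro group_hom.intro group_hom_axioms.intro group_aut_group
        subgroup.subgroup_is_group[OF H is_group]) (auto simp: hom_def Pi_iff)
  \<comment> \<open>The inclusion of \<open>SS\<close> in \<open>H\<close> makes the kernel of the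
    restricted action all of \<open>SS\<close>.\<close>
  have kernel: "kernel ?H (aut_group (affine_plane_at S x)) (plane_action S x) = SS"
    using SS_H HT by (auto simp: kernel_def plane_action_eq_one_iff)
  have normal: "SS \<lhd> ?H"
    using plane_H.normal_kernel by (simp add: kernel)
  have hom: "\<psi> \<in> hom (?H Mod SS) (aut_group (affine_plane_at S x))"
    using plane_H.FactGroup_hom by (simp add: kernel \<psi>_def)
  have inj: "inj_on \<psi> (carrier (?H Mod SS))"
    using plane_H.FactGroup_inj_on by (simp add: kernel \<psi>_def)
  have \<psi>: "\<psi> (SS #>\<^bsub>T\<^esub> g) = plane_action S x g" if g: "g \<in> H" for g
  proof -
    have "plane_action S x (n \<otimes>\<^bsub>T\<^esub> g) = plane_action S x g" if n: "n \<in> SS" for n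
      using plane_action_eq_one_iff[of n] n SS_carrier HT[OF g] by (simp del: carrier_aut_group)
    then have "(\<lambda>n. plane_action S x (n \<otimes>\<^bsub>T\<^esub> g)) ` SS = {plane_action S x g}"
      using image_constant[OF subgroup.one_closed[OF SS_subgroup]] by (simp cong: image_cong)
    moreover have "plane_action S x ` (SS #>\<^bsub>T\<^esub> g) = (\<lambda>n. plane_action S x (n \<otimes>\<^bsub>T\<^esub> g)) ` SS"
      by (simp add: r_coset_def UNION_singleton_eq_range image_image)
    ultimately have "plane_action S x ` (SS #>\<^bsub>T\<^esub> g) = {plane_action S x g}"
      by simp
    then show ?thesis by (simp add: \<psi>_def)
  qed
  have coset: "C \<in> carrier (?H Mod SS) \<longleftrightarrow> (\<exists>g\<in>H. C = SS #>\<^bsub>T\<^esub> g)" for C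
    by (auto simp: FactGroup_def RCOSETS_def r_coset_def)
  have sharp: "sharply_transitive (carrier (?H Mod SS)) (\<lambda>C. fst (\<psi> C)) (points (affine_plane_at S x))"
    unfolding sharply_transitive_def
  proof (intro ballI ex_ex1I)
    fix A B assume "A \<in> points (affine_plane_at S x)" "B \<in> points (affine_plane_at S x)"
    then obtain z w where zw: "z \<in> ?far" "w \<in> ?far" "A = perp S {x, z}" "B = perp S {x, w}"
      unfolding points_affine_plane_at by blast
    then obtain g where "g \<in> H" "fst (payne_action S x g) z = w"
      using singer unfolding singer_group_def sharply_transitive_def by blast
    then have "SS #>\<^bsub>T\<^esub> g \<in> carrier (?H Mod SS) \<and> fst (\<psi> (SS #>\<^bsub>T\<^esub> g)) A = B"
      using zw fst_plane_action[OF HT zw(1)] fst_payne_action[OF zw(1)] by (auto simp: coset \<psi>)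
    then show "\<exists>C. C \<in> carrier (?H Mod SS) \<and> fst (\<psi> C) A = B" ..
  next
    fix A B C D assume A: "A \<in> points (affine_plane_at S x)"
      and C: "C \<in> carrier (?H Mod SS) \<and> fst (\<psi> C) A = B"
      and D: "D \<in> carrier (?H Mod SS) \<and> fst (\<psi> D) A = B"
    obtain z where z: "z \<in> ?far" "A = perp S {x, z}"
      using A unfolding points_affine_plane_at by blast
    obtain g where g: "g \<in> H" "C = SS #>\<^bsub>T\<^esub> g"
      using C[THEN conjunct1] unfolding coset by (elim bexE)
    obtain h where h: "h \<in> H" "D = SS #>\<^bsub>T\<^esub> h"
      using D[THEN conjunct1] unfolding coset by (elim bexE)
    have T: "g \<in> carrier T" "h \<in> carrier T" using HT[OF g(1)] HT[OF h(1)] .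
    have "fst (plane_action S x g) A = fst (plane_action S x h) A"
      using C[THEN conjunct2] D[THEN conjunct2] unfolding g(2) h(2) \<psi>[OF g(1)] \<psi>[OF h(1)] by simp
    then have "perp S {x, fst g z} = perp S {x, fst h z}"
      unfolding z(2) fst_plane_action[OF T(1) z(1)] fst_plane_action[OF T(2) z(1)] .
    moreover have "fst g z \<in> ?far" "fst h z \<in> ?far"
      using T z by (simp_all add: stabilizerD)
    ultimately obtain n where n: "n \<in> SS" "fst n (fst h z) = fst g z"
      using SS_transitive_on_trace by blast
    have nT: "n \<in> carrier T" using n SS_carrier by blast
    have nh: "n \<otimes>\<^bsub>T\<^esub> h \<in> H" using n h SS_H subgroup.m_closed[OF H] by blast
    have "fst (payne_action S x (n \<otimes>\<^bsub>T\<^esub> h)) z = fst (payne_action S x g) z"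
      unfolding fst_payne_action[OF z(1)] using z n mult_aut_stabilizer(1)[OF nT T(2), of z] by simp
    moreover have "fst (payne_action S x g) z \<in> ?far"
      using fst_payne_action[OF z(1)] \<open>fst g z \<in> ?far\<close> by simp
    \<comment> \<open>Both induced elements lie in the Singer group and agree at \<open>z\<close>.
      Faithfulness then lifts their equality to \<open>T\<close>.\<close>
    ultimately have "payne_action S x (n \<otimes>\<^bsub>T\<^esub> h) = payne_action S x g"
      using singer nh g(1) z(1) unfolding singer_group_def sharply_transitive_def
      by (metis imageI)
    then have "n \<otimes>\<^bsub>T\<^esub> h = g"
      using inj_onD[OF payne_action_inj] m_closed[OF nT T(2)] T(1) by blast
    then have "plane_action S x g = plane_action S x h"
      using plane_action_eq_one_iff[OF nT] n nT T by (auto simp del: carrier_aut_group)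
    then have "\<psi> C = \<psi> D" using \<psi> g h by simp
    then show "C = D" using inj C D by (simp add: inj_on_eq_iff)
  qed
  from normal hom \<psi> inj sharp show ?thesis by blast
qed

text \<open>To move \<open>z\<close> to \<open>w\<close>, an element of \<open>H\<close> first
  matches the traces and an element of \<open>SS\<close> then moves within the fibre. Uniqueness
  combines sharpness on the plane with the freeness of \<open>SS\<close> on each fibre.\<close>

lemma plane_group_induces_singer_group:
  assumes sharp: "sharply_transitive (plane_action S x ` H) fst (points (affine_plane_at S x))"
    and H: "subgroup H T"
  shows "singer_group (payne_derived S x) (payne_action S x ` generate T (SS \<union> H))"
proof -
  let ?K = "generate T (SS \<union> H)"
  let ?far = "points (payne_derived S x)"
  have SH: "SS \<union> H \<subseteq> carrier T"
    using subgroup.subset[OF H] subgroup.subset[OF SS_subgroup] by blast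
  have K: "subgroup ?K T" using generate_is_subgroup[OF SH] .
  have KT: "g \<in> carrier T" if "g \<in> ?K" for g
    using that subgroup.subset[OF K] by blast
  \<comment> \<open>Adjoining \<open>SS\<close> does not enlarge the group induced on the plane,
    since \<open>SS\<close> acts trivially there; sharpness thus applies to all of
    \<open>?K\<close>.\<close>
  have plane_K: "plane_action S x g \<in> plane_action S x ` H" if "g \<in> ?K" for g
  proof -
    have img: "subgroup (plane_action S x ` H) (aut_group (affine_plane_at S x))"
      using plane.subgroup_img_is_subgroup[OF H] .
    have "plane_action S x ` ?K = generate (aut_group (affine_plane_at S x)) (plane_action S x ` (SS \<union> H))"
      using plane.generate_img[OF SH] by simp
    also have "\<dots> \<subseteq> plane_action S x ` H"
    proof (rule plane.H.generate_subgroup_incl[OF _ img])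
      have "plane_action S x n \<in> plane_action S x ` H" if "n \<in> SS" for n
        using that plane_action_eq_one_iff[of n] SS_carrier subgroup.one_closed[OF img] by auto
      then show "plane_action S x ` (SS \<union> H) \<subseteq> plane_action S x ` H" by blast
    qed
    finally show ?thesis using that by blast
  qed
  have "sharply_transitive (payne_action S x ` ?K) fst ?far"
    unfolding sharply_transitive_def
  proof (intro ballI ex_ex1I)
    fix z w assume z: "z \<in> ?far" and w: "w \<in> ?far"
    then have "perp S {x, z} \<in> points (affine_plane_at S x)" "perp S {x, w} \<in> points (affine_plane_at S x)"
      unfolding points_affine_plane_at by blast+
    then obtain h where h: "h \<in> H" "fst (plane_action S x h) (perp S {x, z}) = perp S {x, w}"
      using sharp unfolding sharply_transitive_def by blast
    have hT: "h \<in> carrier T" using h SH by blast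
    have "perp S {x, w} = perp S {x, fst h z}" using h fst_plane_action[OF hT z] by simp
    moreover have hz: "fst h z \<in> ?far" using hT z by (simp add: stabilizerD)
    ultimately obtain n where n: "n \<in> SS" "fst n (fst h z) = w"
      using SS_transitive_on_trace[OF hz w] by blast
    have nh: "n \<otimes>\<^bsub>T\<^esub> h \<in> ?K"
      using n h by (intro generate.eng generate.incl) auto
    have "fst (n \<otimes>\<^bsub>T\<^esub> h) z = w"
      using mult_aut_stabilizer(1)[OF SS_carrier[OF n(1)] hT, of z] z n by simp
    with nh show "\<exists>g. g \<in> payne_action S x ` ?K \<and> fst g z = w"
      using fst_payne_action[OF z] by blast
  next
    fix z w a b assume z: "z \<in> ?far"
      and a: "a \<in> payne_action S x ` ?K \<and> fst a z = w"
      and b: "b \<in> payne_action S x ` ?K \<and> fst b z = w"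
    then obtain g h where g: "g \<in> ?K" "a = payne_action S x g" and h: "h \<in> ?K" "b = payne_action S x h"
      by blast
    have T: "g \<in> carrier T" "h \<in> carrier T" using g h KT by auto
    have eq: "fst g z = fst h z" using a b g h fst_payne_action[OF z] by simp
    have "fst (plane_action S x g) (perp S {x, z}) = fst (plane_action S x h) (perp S {x, z})"
      using fst_plane_action[OF _ z] T eq by simp
    moreover have "perp S {x, z} \<in> points (affine_plane_at S x)"
        "fst (plane_action S x h) (perp S {x, z}) \<in> points (affine_plane_at S x)"
      using z T fst_plane_action[OF T(2) z] unfolding points_affine_plane_at
      by (auto simp: stabilizerD)
    \<comment> \<open>Agreement at \<open>z\<close> gives agreement at its trace, and sharp
      transitivity on the plane identifies the induced elements.\<close>
    ultimately have "plane_action S x g = plane_action S x h"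
      using sharp plane_K[OF g(1)] plane_K[OF h(1)] unfolding sharply_transitive_def by metis
    then show "a = b" using eq_if_plane_action_eq[OF T _ z eq] g h by simp
  qed
  then show ?thesis
    unfolding singer_group_def using payne.subgroup_img_is_subgroup[OF K] by blast
qed

end

theorem mainTheorem1:
  fixes S :: "('p, 'l) incidence_structure"
    and s :: nat
    and x :: 'p
    and SS :: "(('p \<Rightarrow> 'p) \<times> ('l \<Rightarrow> 'l)) set"
  assumes "generalized_quadrangle S s s"
    and "finite_structure S"
    and "thick S"
    and "regular_point S s x"
    and "subgroup SS (aut_stabilizer S x)"
    and "card SS = s"
    and "\<forall>g\<in>SS. is_symmetry S x g"
  shows
    "(\<forall>G Gbar.
        singer_group (payne_derived S x) G \<and>
        subgroup Gbar (aut_stabilizer S x) \<and> SS \<subseteq> Gbar \<and>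
        G = payne_action S x ` Gbar
      \<longrightarrow>
        SS \<lhd> (aut_stabilizer S x)\<lparr>carrier := Gbar\<rparr> \<and>
        (\<exists>\<psi>. \<psi> \<in> hom ((aut_stabilizer S x)\<lparr>carrier := Gbar\<rparr> Mod SS)
                       (aut_group (affine_plane_at S x)) \<and>
             (\<forall>g\<in>Gbar. \<psi> (SS #>\<^bsub>aut_stabilizer S x\<^esub> g) = plane_action S x g) \<and>
             inj_on \<psi> (carrier ((aut_stabilizer S x)\<lparr>carrier := Gbar\<rparr> Mod SS)) \<and>
             sharply_transitive (carrier ((aut_stabilizer S x)\<lparr>carrier := Gbar\<rparr> Mod SS))
               (\<lambda>C. fst (\<psi> C)) (points (affine_plane_at S x))))
     \<and>
     (\<forall>K Ksharp.
        subgroup K (aut_group (affine_plane_at S x)) \<and>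
        sharply_transitive K fst (points (affine_plane_at S x)) \<and>
        subgroup Ksharp (aut_stabilizer S x) \<and>
        K = plane_action S x ` Ksharp
      \<longrightarrow>
        singer_group (payne_derived S x)
          (payne_action S x ` generate (aut_stabilizer S x) (SS \<union> Ksharp)))"
proof -
  interpret generalized_quadrangle S s s by fact
  have x: "x \<in> points S"
    using assms(4) by (simp add: regular_point_def)
  obtain l where "l \<in> lines S" using nonempty by blast
  then have "2 \<le> s"
    using assms(3) points_on_line[of l] by (auto simp: thick_def)
  then interpret full_symmetry_group S s x SS
    using assms x
    by (intro full_symmetry_group.intro point_stabilizer.intro full_symmetry_group_axioms.intro) blast+
  show ?thesis
    using singer_group_induces_plane_group plane_group_induces_singer_group by blast
qed

end
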